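(* Let $m\ge n$, $q\ge1$, let $A\in\mathbb{R}^{m\times n}$ have rank $n$, let $b\in\mathbb{R}^m$, and let $\Gamma\in\mathbb{R}^{q\times n}$ be such that $\bar A=\begin{bmatrix}A\\ \Gamma\end{bmatrix}=[\bar A^1\ \dots\ \bar A^p]$ has mutually orthogonal column blocks $\bar A^i$ (as described in the context). Put $\bar m=m+q$, $\bar P=\bar A\bar A^+$, $Y=\begin{bmatrix}0\\ I_q\end{bmatrix}\in\mathbb{R}^{\bar m\times q}$, and $W=(I_{\bar m}-\bar P)Y=\begin{bmatrix}B\\ S\end{bmatrix}$ with $B\in\mathbb{R}^{m\times q}$, $S\in\mathbb{R}^{q\times q}$. Let $\Omega=I_n+(\bar A^T\bar A)^{-1}\Gamma^TS^{-1}\Gamma$, where $\bar A^T\bar A=A^TA+\Gamma^T\Gamma$. Consider the least squares problems $$\text{(P1)}\quad \|Ax-b\|=\min!,\ x\in\mathbb{R}^n,\qquad\qquad \text{(P2)}\quad \left\|\begin{bmatrix}A&B\\ \Gamma&S\end{bmatrix}\begin{bmatrix}y\\ z\end{bmatrix}-\begin{bmatrix}b\\ 0\end{bmatrix}\right\|=\min!,\ y\in\mathbb{R}^n,\ z\in\mathbb{R}^q .$$ Then the following hold. (i) Let $x_{LS}$ be the minimal norm solution of (P1) and let $y=\Omega^{-1}x_{LS}$, $z=-S^{-1}\Gamma y$. Then $\begin{bmatrix}y\\ z\end{bmatrix}$ is the minimal norm solution of (P2). (ii) Let $\begin{bmatrix}y\\ z\end{bmatrix}$ be the minimal norm solution of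 (P2). Then $z=-S^{-1}\Gamma y$, and $$x_{LS}=\Omega y=\left(I_n+(\bar A^T\bar A)^{-1}\Gamma^TS^{-1}\Gamma\right)y$$ is the minimal norm solution of (P1). (iii) The minimal norm solution of (P2) is given by $$\begin{bmatrix}y\\ z\end{bmatrix}_{LS}=\begin{bmatrix}(\bar A^T\bar A)^{-1}A^Tb\\ -S^{-1}\Gamma(\bar A^T\bar A)^{-1}A^Tb\end{bmatrix},$$ where $(\bar A^T\bar A)^{-1}$ is the block diagonal matrix with diagonal blocks $\big((\bar A^1)^T\bar A^1\big)^{-1},\big((\bar A^2)^T\bar A^2\big)^{-1},\dots,\big((\bar A^p)^T\bar A^p\big)^{-1}$.
   Context: $M^+$ denotes the Moore-Penrose pseudoinverse of a real matrix $M$, $I_k$ the identity matrix of order $k$, $\|\cdot\|$ the Euclidean norm. The matrices are partitioned into column blocks $A=[A^1\ \dots\ A^p]$, $\Gamma=[\Gamma^1\ \dots\ \Gamma^p]$ with $A^i\in\mathbb{R}^{m\times n_i}$, $\Gamma^i\in\mathbb{R}^{q\times n_i}$, $n_1+\dots+n_p=n$, and with $\bar A^i=\begin{bmatrix}A^i\\ \Gamma^i\end{bmatrix}$ it is assumed that $(\bar A^i)^T\bar A^j=0$ for all $i\ne j$. Under these assumptions the matrices $S$ and $\Omega$ are invertible. The minimal norm solution of a least squares problem is its minimizer of smallest Euclidean norm. *)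

theory Defs
  imports
    Complex_Main
    "Jordan_Normal_Form.Gauss_Jordan_Elimination"
    "Jordan_Normal_Form.DL_Rank"
begin

definition vnorm :: "real vec \<Rightarrow> real" where
  "vnorm v = sqrt (v \<bullet> v)"

(* Unspecified for a singular matrix, where mat_inverse returns None. *)
definition mat_inv :: "real mat \<Rightarrow> real mat" where
  "mat_inv M = the (mat_inverse M)"

lemma mat_inv_eqI:
  assumes M: "M \<in> carrier_mat k k" and N: "N \<in> carrier_mat k k"
    and MN: "M * N = 1\<^sub>m k" and NM: "N * M = 1\<^sub>m k"
  shows "mat_inv M = N"
proof (cases "mat_inverse M")
  case None
  have "M \<in> Units (ring_mat TYPE(real) k ())"
    using M N MN NM by (auto simp: Units_def ring_mat_simps)
  with mat_inverse(1)[OF M None, where b = "()"] show ?thesis by blast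
next
  case (Some X)
  from mat_inverse(2)[OF M Some]
  have X: "X \<in> carrier_mat k k" "X * M = 1\<^sub>m k" by auto
  have "X = X * (M * N)" using X(1) MN by simp
  also have "\<dots> = (X * M) * N" using assoc_mult_mat[OF X(1) M N] by simp
  also have "\<dots> = N" using X(2) N by simp
  finally show ?thesis using Some by (simp add: mat_inv_def)
qed

(* The four Penrose equations. *)
definition is_pinv :: "real mat \<Rightarrow> real mat \<Rightarrow> bool" where
  "is_pinv M X \<longleftrightarrow> X \<in> carrier_mat (dim_col M) (dim_row M)
     \<and> M * X * M = M \<and> X * M * X = X
     \<and> transpose_mat (M * X) = M * X \<and> transpose_mat (X * M) = X * M"

definition pinv :: "real mat \<Rightarrow> real mat" where
  "pinv M = (THE X. is_pinv M X)"

lemma is_pinv_unique: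
  assumes "is_pinv M X" and "is_pinv M Z"
  shows "X = Z"
proof -
  define r c where "r = dim_row M" and "c = dim_col M"
  have M: "M \<in> carrier_mat r c" by (simp add: r_def c_def)
  have X: "X \<in> carrier_mat c r" and Z: "Z \<in> carrier_mat c r"
    using assms by (auto simp: is_pinv_def r_def c_def)
  note X_eqs = assms(1)[unfolded is_pinv_def]
  note Z_eqs = assms(2)[unfolded is_pinv_def]
  have MX: "M * X \<in> carrier_mat r r" and MZ: "M * Z \<in> carrier_mat r r"
    and XM: "X * M \<in> carrier_mat c c" and ZM: "Z * M \<in> carrier_mat c c"
    using M X Z by auto
  have "M * X = transpose_mat ((M * Z * M) * X)" using X_eqs Z_eqs by simp
  also have "(M * Z * M) * X = (M * Z) * (M * X)" using assoc_mult_mat[OF MZ M X] .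
  also have "transpose_mat \<dots> = (M * X) * (M * Z)"
    using transpose_mult[OF MZ MX] X_eqs Z_eqs by simp
  also have "\<dots> = (M * X * M) * Z" using assoc_mult_mat[OF MX M Z] by simp
  also have "\<dots> = M * Z" using X_eqs by simp
  finally have left: "M * X = M * Z" .
  have "X * M = transpose_mat (X * (M * Z * M))" using X_eqs Z_eqs by simp
  also have "X * (M * Z * M) = (X * M) * (Z * M)"
    using assoc_mult_mat[OF M Z M] assoc_mult_mat[OF X M ZM] by simp
  also have "transpose_mat \<dots> = (Z * M) * (X * M)"
    using transpose_mult[OF XM ZM] X_eqs Z_eqs by simp
  also have "\<dots> = Z * (M * X * M)"
    using assoc_mult_mat[OF M X M] assoc_mult_mat[OF Z M XM] by simp
  also have "\<dots> = Z * M" using X_eqs by simp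
  finally have right: "X * M = Z * M" .
  have "X = X * M * X" using X_eqs by simp
  also have "\<dots> = Z * (M * X)" using right assoc_mult_mat[OF Z M X] by simp
  also have "\<dots> = Z * M * Z" using left assoc_mult_mat[OF Z M Z] by simp
  also have "\<dots> = Z" using Z_eqs by simp
  finally show ?thesis .
qed

lemma pinv_eqI: "is_pinv M X \<Longrightarrow> pinv M = X"
  unfolding pinv_def using is_pinv_unique by blast

(* Blocks side by side; the row count k matters only for the empty list. *)
definition hcat :: "nat \<Rightarrow> real mat list \<Rightarrow> real mat" where
  "hcat k Ms = mat_of_cols k (concat (map cols Ms))"

lemma hcat_append_rows:
  assumes "\<And>i. i \<in> set is \<Longrightarrow> M i \<in> carrier_mat k (ns i)"
    and "\<And>i. i \<in> set is \<Longrightarrow> N i \<in> carrier_mat l (ns i)"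
  shows "hcat (k + l) (map (\<lambda>i. M i @\<^sub>r N i) is) = hcat k (map M is) @\<^sub>r hcat l (map N is)"
proof -
  have len: "length (concat (map (\<lambda>i. cols (M i)) js)) = (\<Sum>i\<leftarrow>js. dim_col (M i))"
    for M :: "'a \<Rightarrow> real mat" and js
    by (induction js) auto
  have nths: "concat (map (\<lambda>i. cols (M i @\<^sub>r N i)) is) ! j =
      concat (map (\<lambda>i. cols (M i)) is) ! j @\<^sub>v concat (map (\<lambda>i. cols (N i)) is) ! j
    \<and> concat (map (\<lambda>i. cols (M i)) is) ! j \<in> carrier_vec k
    \<and> concat (map (\<lambda>i. cols (N i)) is) ! j \<in> carrier_vec l"
    if "j < (\<Sum>i\<leftarrow>is. ns i)" for j
    using assms that
  proof (induction "is" arbitrary: j)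
    case (Cons i js)
    have MN: "M i \<in> carrier_mat k (ns i)" "N i \<in> carrier_mat l (ns i)"
      using Cons.prems by auto
    have dims: "dim_col (M i @\<^sub>r N i) = ns i" "dim_col (M i) = ns i" "dim_col (N i) = ns i"
      using MN by (auto simp: append_rows_def)
    have col: "col (M i @\<^sub>r N i) j' = col (M i) j' @\<^sub>v col (N i) j'" if "j' < ns i" for j'
      using that MN by (intro eq_vecI) (auto simp: append_rows_def)
    show ?case
    proof (cases "j < ns i")
      case True
      then show ?thesis using MN dims col by (auto simp: nth_append)
    next
      case False
      then show ?thesis using Cons.IH[of "j - ns i"] Cons.prems dims
        by (simp add: nth_append)
    qed
  qed simp
  have sums: "(\<Sum>i\<leftarrow>is. dim_col (M i)) = (\<Sum>i\<leftarrow>is. ns i)"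
    "(\<Sum>i\<leftarrow>is. dim_col (N i)) = (\<Sum>i\<leftarrow>is. ns i)"
    "(\<Sum>i\<leftarrow>is. dim_col (M i @\<^sub>r N i)) = (\<Sum>i\<leftarrow>is. ns i)"
    using assms by (auto intro!: arg_cong[where f = sum_list] map_cong simp: append_rows_def)
  show ?thesis
  proof (rule eq_matI)
    fix i j
    assume "i < dim_row (hcat k (map M is) @\<^sub>r hcat l (map N is))"
      and "j < dim_col (hcat k (map M is) @\<^sub>r hcat l (map N is))"
    then have i: "i < k + l" and j: "j < (\<Sum>i\<leftarrow>is. ns i)"
      by (auto simp: hcat_def append_rows_def comp_def len sums)
    let ?u = "concat (map (\<lambda>i. cols (M i)) is) ! j"
    let ?v = "concat (map (\<lambda>i. cols (N i)) is) ! j"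
    have "hcat (k + l) (map (\<lambda>i. M i @\<^sub>r N i) is) $$ (i, j) = (?u @\<^sub>v ?v) $ i"
      using i j nths[OF j] by (simp add: hcat_def mat_of_cols_def comp_def len sums)
    also have "\<dots> = (if i < k then ?u $ i else ?v $ (i - k))"
      using i conjunct2[OF nths[OF j]] by auto
    also have "\<dots> = (hcat k (map M is) @\<^sub>r hcat l (map N is)) $$ (i, j)"
      using i j by (simp add: hcat_def append_rows_def mat_of_cols_def comp_def len sums)
    finally show "hcat (k + l) (map (\<lambda>i. M i @\<^sub>r N i) is) $$ (i, j) =
        (hcat k (map M is) @\<^sub>r hcat l (map N is)) $$ (i, j)" .
  qed (auto simp: hcat_def append_rows_def comp_def len sums)
qed

lemma gram_append_rows:
  fixes M N :: "real mat"
  assumes M: "M \<in> carrier_mat k n" and N: "N \<in> carrier_mat l n"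
  shows "transpose_mat (M @\<^sub>r N) * (M @\<^sub>r N) = transpose_mat M * M + transpose_mat N * N"
proof (rule eq_matI)
  fix i j assume "i < dim_row (transpose_mat M * M + transpose_mat N * N)"
    and "j < dim_col (transpose_mat M * M + transpose_mat N * N)"
  then have ij: "i < n" "j < n" using M N by auto
  have "col (M @\<^sub>r N) h = col M h @\<^sub>v col N h" if "h < n" for h
    using that M N by (intro eq_vecI) (auto simp: append_rows_def)
  moreover have "dim_row (M @\<^sub>r N) = k + l" "dim_col (M @\<^sub>r N) = n"
    using M N by (auto simp: append_rows_def)
  moreover have "col M h \<in> carrier_vec k" "col N h \<in> carrier_vec l" for h
    using M N by auto
  ultimately show "(transpose_mat (M @\<^sub>r N) * (M @\<^sub>r N)) $$ (i, j) =
      (transpose_mat M * M + transpose_mat N * N) $$ (i, j)"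
    using ij M N by (simp add: scalar_prod_append[where ?n1.0 = k and ?n2.0 = l])
qed (use M N in \<open>auto simp: append_rows_def\<close>)

definition is_least_squares :: "real mat \<Rightarrow> real vec \<Rightarrow> real vec \<Rightarrow> bool" where
  "is_least_squares M c x \<longleftrightarrow>
     is_arg_min (\<lambda>x. vnorm (M *\<^sub>v x - c)) (\<lambda>x. x \<in> carrier_vec (dim_col M)) x"

(* The strict inequality makes x the unique minimizer of smallest norm. *)
definition is_min_norm_ls :: "real mat \<Rightarrow> real vec \<Rightarrow> real vec \<Rightarrow> bool" where
  "is_min_norm_ls M c x \<longleftrightarrow> is_least_squares M c x
     \<and> (\<forall>x'. is_least_squares M c x' \<and> x' \<noteq> x \<longrightarrow> vnorm x < vnorm x')"

end

theory Submission
  imports Defs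
begin

text \<open>Write $C = A^T A$, $R = C^{-1}$, $H = \bar A^T \bar A = C + \Gamma^T\Gamma$ and $G = H^{-1}$.
  Since $A$ and $\bar A$ have full column rank, $\bar A^+ = G \bar A^T$, so that
  $B = - A G \Gamma^T$ and $S = I - \Gamma G \Gamma^T$. The Woodbury identity gives
  $S^{-1} = I + \Gamma R \Gamma^T$, whence $\Omega = R H$ and $\Omega^{-1} = G C$. As $W$ is
  orthogonal to the columns of $\bar A$, the Gram matrix of $K = [\bar A \; W]$ is
  $\mathrm{diag}(H, S)$. Both least squares problems thus have a unique solution, given by the
  normal equations: $x = R A^T b$ and $y = G A^T b$, $z = - S^{-1} \Gamma y$, so $y = \Omega^{-1} x$.\<close>

section \<open>Inverses of nonsingular square matrices\<close>

lemma mat_inv_nonsingular: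
  assumes M: "M \<in> carrier_mat k k" and det: "det M \<noteq> 0"
  shows "mat_inv M \<in> carrier_mat k k" "mat_inv M * M = 1\<^sub>m k" "M * mat_inv M = 1\<^sub>m k"
proof -
  obtain X where "mat_inverse M = Some X"
    using det_non_zero_imp_unit[OF M det, of "()"] mat_inverse(1)[OF M, where b = "()"]
    by (cases "mat_inverse M") auto
  then show "mat_inv M \<in> carrier_mat k k" "mat_inv M * M = 1\<^sub>m k" "M * mat_inv M = 1\<^sub>m k"
    using mat_inverse(2)[OF M] by (auto simp: mat_inv_def)
qed

text \<open>Over a field a one-sided inverse of a square matrix is two-sided. Each inverse
  identified below therefore needs only one product to be checked.\<close>

lemma mat_inv_left_inverse:
  assumes M: "M \<in> carrier_mat k k" and X: "X \<in> carrier_mat k k" and MX: "M * X = 1\<^sub>m k"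
  shows "mat_inv M = X"
  using mat_inv_eqI[OF M X MX mat_mult_left_right_inverse[OF M X MX]] .

lemma transpose_mat_inv:
  assumes M: "M \<in> carrier_mat k k" and det: "det M \<noteq> 0"
  shows "transpose_mat (mat_inv M) = mat_inv (transpose_mat M)"
proof -
  note inv = mat_inv_nonsingular[OF M det]
  have "transpose_mat M * transpose_mat (mat_inv M) = 1\<^sub>m k"
    using transpose_mult[OF inv(1) M] inv(2) by simp
  then show ?thesis
    using mat_inv_left_inverse[of "transpose_mat M" k "transpose_mat (mat_inv M)"] M inv(1) by simp
qed

section \<open>Matrix-vector algebra and the Euclidean inner product\<close>

lemma mult_mat_vec_zero:
  "(M :: 'a :: semiring_0 mat) \<in> carrier_mat r k \<Longrightarrow> M *\<^sub>v 0\<^sub>v k = 0\<^sub>v r"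
  by (intro eq_vecI) auto

lemma mult_mat_vec_uminus:
  fixes M :: "'a :: ring mat"
  assumes "M \<in> carrier_mat r k" "v \<in> carrier_vec k"
  shows "M *\<^sub>v (- v) = - (M *\<^sub>v v)"
  using assms by (intro eq_vecI) auto

lemma scalar_prod_self_nonneg: "0 \<le> (v :: real vec) \<bullet> v"
  by (simp add: scalar_prod_def sum_nonneg)

lemma scalar_prod_self_eq_0_iff:
  fixes v :: "real vec"
  assumes "v \<in> carrier_vec k"
  shows "v \<bullet> v = 0 \<longleftrightarrow> v = 0\<^sub>v k"
proof -
  have "v \<bullet> v = 0 \<longleftrightarrow> (\<forall>i\<in>{0..<k}. v $ i * v $ i = 0)"
    using assms by (simp add: scalar_prod_def sum_nonneg_eq_0_iff)
  then show ?thesis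
    using assms by (auto intro!: eq_vecI)
qed

section \<open>Gram matrices, full column rank, the pseudoinverse and least squares\<close>

lemma scalar_prod_gram:
  fixes M :: "real mat"
  assumes M: "M \<in> carrier_mat r k" and v: "v \<in> carrier_vec k"
  shows "v \<bullet> (transpose_mat M * M *\<^sub>v v) = (M *\<^sub>v v) \<bullet> (M *\<^sub>v v)"
proof -
  have Mv: "M *\<^sub>v v \<in> carrier_vec r" using mult_mat_vec_carrier[OF M v] .
  have "v \<bullet> (transpose_mat M * M *\<^sub>v v) = (transpose_mat M *\<^sub>v (M *\<^sub>v v)) \<bullet> v"
    using M v Mv by (subst comm_scalar_prod[of _ k]) auto
  then show ?thesis using transpose_vec_mult_scalar[OF M v Mv] by simp
qed

text \<open>The rank is the size of a maximal independent set of columns, so it is at most the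
  number of different columns; a repeated column would push it below \<open>k\<close>. This matters
  because linear independence is a property of the set \<open>set (cols A)\<close>, in which
  repetitions are invisible.\<close>

lemma (in vec_space) full_column_rank_imp_distinct_cols:
  assumes A: "A \<in> carrier_mat n k" and rank: "rank A = k"
  shows "distinct (cols A)"
proof -
  \<comment> \<open>The empty set is independent and there are only finitely many columns, so a
    maximal independent subset exists; \<open>rank_card_indpt\<close> equates its size with the
    rank.\<close>
  obtain T where T: "maximal T (\<lambda>T. T \<subseteq> set (cols A) \<and> lin_indpt T)"
    using maximal_exists[of "\<lambda>T. T \<subseteq> set (cols A) \<and> lin_indpt T" "card (set (cols A))" "{}"]
    by (meson List.finite_set card_mono empty_iff empty_subsetI finite_lin_indpt2 rev_finite_subset)
  then have "card T \<le> card (set (cols A))" by (simp add: card_mono maximal_def)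
  then have "length (cols A) \<le> card (set (cols A))"
    using rank_card_indpt[OF A T] rank A by simp
  then show ?thesis using card_length card_distinct le_antisym by metis
qed

text \<open>The entries of a nonzero kernel vector would be the coefficients of a linear relation
  between the columns. Distinctness of the columns permits the passage from the list of columns to
  the set, whose independence is what full rank provides.\<close>

lemma full_column_rank_kernel:
  assumes A: "A \<in> carrier_mat r k" and rank: "vec_space.rank r A = k"
    and v: "v \<in> carrier_vec k" and Av: "A *\<^sub>v v = 0\<^sub>v r"
  shows "v = (0\<^sub>v k :: 'a :: field vec)"
proof (rule ccontr)
  interpret vec_space "TYPE('a)" r .
  assume "v \<noteq> 0\<^sub>v k"
  moreover have distinct: "distinct (cols A)"
    using full_column_rank_imp_distinct_cols[OF A rank] .
  ultimately show False
    using lin_depI[OF A v _ Av] full_rank_lin_indpt[OF A rank] by blast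
qed

text \<open>If \<open>transpose_mat M * M\<close> annihilates \<open>v\<close>, pairing with
  \<open>v\<close> gives (M v) . (M v) = 0 by \<open>scalar_prod_gram\<close>, so \<open>v\<close>
  already lies in the kernel of \<open>M\<close>.\<close>

lemma det_gram_nonzero:
  fixes M :: "real mat"
  assumes M: "M \<in> carrier_mat r k"
    and kernel: "\<And>v. v \<in> carrier_vec k \<Longrightarrow> M *\<^sub>v v = 0\<^sub>v r \<Longrightarrow> v = 0\<^sub>v k"
  shows "det (transpose_mat M * M) \<noteq> 0"
proof
  assume "det (transpose_mat M * M) = 0"
  then obtain v where v: "v \<in> carrier_vec k" "v \<noteq> 0\<^sub>v k" "transpose_mat M * M *\<^sub>v v = 0\<^sub>v k"
    using det_0_iff_vec_prod_zero_field[of "transpose_mat M * M" k] M by auto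
  then have "(M *\<^sub>v v) \<bullet> (M *\<^sub>v v) = 0"
    using scalar_prod_gram[OF M v(1)] by simp
  then show False
    using kernel[OF v(1)] v(2) scalar_prod_self_eq_0_iff[OF mult_mat_vec_carrier[OF M v(1)]] by simp
qed

text \<open>The proposed matrix is a left inverse of \<open>M\<close>. This settles every Penrose
  equation except the symmetry of \<open>M * X\<close>, which comes from the symmetry of the inverse
  Gram matrix.\<close>

lemma pinv_full_column_rank:
  assumes M: "M \<in> carrier_mat r k" and det: "det (transpose_mat M * M) \<noteq> 0"
  shows "pinv M = mat_inv (transpose_mat M * M) * transpose_mat M"
proof (rule pinv_eqI)
  define N where "N = mat_inv (transpose_mat M * M)"
  have MM: "transpose_mat M * M \<in> carrier_mat k k" using M by simp
  note N = mat_inv_nonsingular[OF MM det, folded N_def]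
  have N_sym: "transpose_mat N = N"
    using transpose_mat_inv[OF MM det] transpose_mult[of "transpose_mat M" k r M k] M
    by (simp add: N_def)
  have Mt: "transpose_mat M \<in> carrier_mat k r" using M by simp
  have NMt: "N * transpose_mat M \<in> carrier_mat k r" using N(1) Mt by simp
  have left: "N * transpose_mat M * M = 1\<^sub>m k"
    using assoc_mult_mat[OF N(1) Mt M] N(2) by simp
  have "transpose_mat (M * (N * transpose_mat M)) = M * (N * transpose_mat M)"
    using transpose_mult[OF M NMt] transpose_mult[OF N(1) Mt] assoc_mult_mat[OF M N(1) Mt] N_sym
    by simp
  moreover have "M * (N * transpose_mat M) * M = M"
    using assoc_mult_mat[OF M NMt M] left M by simp
  moreover have "N * transpose_mat M * M * (N * transpose_mat M) = N * transpose_mat M"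
    unfolding left using left_mult_one_mat[OF NMt] .
  ultimately show "is_pinv M (mat_inv (transpose_mat M * M) * transpose_mat M)"
    unfolding is_pinv_def N_def[symmetric] using left NMt M by simp
qed

text \<open>For injective $M$ the minimal norm condition is void: the solution of the normal equations
  is the only minimizer, by Pythagoras.\<close>

lemma is_min_norm_ls_iff_normal_equations:
  assumes M: "M \<in> carrier_mat r k" and c: "c \<in> carrier_vec r"
    and N: "N \<in> carrier_mat k k" and MMN: "transpose_mat M * M * N = 1\<^sub>m k"
  shows "is_min_norm_ls M c x \<longleftrightarrow> x = N *\<^sub>v (transpose_mat M *\<^sub>v c)"
proof -
  define x0 where "x0 = N *\<^sub>v (transpose_mat M *\<^sub>v c)"
  define e where "e = M *\<^sub>v x0 - c"
  have Mt: "transpose_mat M \<in> carrier_mat k r" using M by simp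
  have MM: "transpose_mat M * M \<in> carrier_mat k k" using M by simp
  have Mtc: "transpose_mat M *\<^sub>v c \<in> carrier_vec k" using mult_mat_vec_carrier[OF Mt c] .
  have x0: "x0 \<in> carrier_vec k" using mult_mat_vec_carrier[OF N Mtc] by (simp add: x0_def)
  have e: "e \<in> carrier_vec r" using mult_mat_vec_carrier[OF M x0] c by (simp add: e_def)
  have NMM: "N * (transpose_mat M * M) = 1\<^sub>m k"
    using mat_mult_left_right_inverse[OF MM N MMN] .
  have "transpose_mat M *\<^sub>v (M *\<^sub>v x0) = transpose_mat M * M * N *\<^sub>v (transpose_mat M *\<^sub>v c)"
    using assoc_mult_mat_vec[OF Mt M x0] assoc_mult_mat_vec[OF MM N Mtc] by (simp add: x0_def)
  then have "transpose_mat M *\<^sub>v (M *\<^sub>v x0) = transpose_mat M *\<^sub>v c"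
    using MMN Mtc by simp
  then have normal: "transpose_mat M *\<^sub>v e = 0\<^sub>v k"
    unfolding e_def using mult_minus_distrib_mat_vec[OF Mt mult_mat_vec_carrier[OF M x0] c] Mtc by simp
  have strict: "vnorm e < vnorm (M *\<^sub>v x - c)" if x: "x \<in> carrier_vec k" and "x \<noteq> x0" for x
  proof -
    define d where "d = x - x0"
    have d: "d \<in> carrier_vec k" using x x0 by (simp add: d_def)
    have Md: "M *\<^sub>v d \<in> carrier_vec r" using mult_mat_vec_carrier[OF M d] .
    have "M *\<^sub>v d \<noteq> 0\<^sub>v r"
    proof
      assume "M *\<^sub>v d = 0\<^sub>v r"
      \<comment> \<open>\<open>N * transpose_mat M\<close> is a left inverse of \<open>M\<close>, so
        \<open>M\<close> is injective.\<close>
      moreover have "d = N *\<^sub>v (transpose_mat M *\<^sub>v (M *\<^sub>v d))"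
        using assoc_mult_mat_vec[OF N MM d] assoc_mult_mat_vec[OF Mt M d] NMM d by simp
      ultimately have "d = 0\<^sub>v k"
        using mult_mat_vec_zero[OF Mt] mult_mat_vec_zero[OF N] by simp
      then have "(x - x0) $ i = 0" if "i < k" for i using that by (simp add: d_def)
      then have "x = x0" using x x0 by (intro eq_vecI) auto
      with \<open>x \<noteq> x0\<close> show False by blast
    qed
    then have pos: "0 < (M *\<^sub>v d) \<bullet> (M *\<^sub>v d)"
      using scalar_prod_self_nonneg[of "M *\<^sub>v d"] scalar_prod_self_eq_0_iff[OF Md] by linarith
    have split: "M *\<^sub>v x - c = e + M *\<^sub>v d"
      unfolding e_def d_def mult_minus_distrib_mat_vec[OF M x x0]
      using M c by (intro eq_vecI) auto
    have orth: "e \<bullet> (M *\<^sub>v d) = 0"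
      using transpose_vec_mult_scalar[OF M d e] normal d by simp
    have "(M *\<^sub>v x - c) \<bullet> (M *\<^sub>v x - c) = e \<bullet> e + (M *\<^sub>v d) \<bullet> (M *\<^sub>v d)"
      unfolding split using orth comm_scalar_prod[OF e Md] e Md
      by (simp add: add_scalar_prod_distrib[of _ r] scalar_prod_add_distrib[of _ r])
    then show ?thesis using pos by (simp add: vnorm_def)
  qed
  have "is_least_squares M c x \<longleftrightarrow> x = x0" for x
  proof
    assume "is_least_squares M c x"
    then show "x = x0"
      using strict[of x] x0 M by (auto simp: is_least_squares_def is_arg_min_def e_def)
  next
    assume "x = x0"
    then show "is_least_squares M c x"
      using strict x0 M by (force simp: is_least_squares_def is_arg_min_def e_def)
  qed
  then show ?thesis by (auto simp: is_min_norm_ls_def x0_def)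
qed

section \<open>Column blocks and block diagonal matrices\<close>

lemma length_concat_cols: "length (concat (map cols Ms)) = (\<Sum>M\<leftarrow>Ms. dim_col M)"
  by (simp add: length_concat comp_def)

lemma hcat_carrier [simp]: "hcat k Ms \<in> carrier_mat k (\<Sum>M\<leftarrow>Ms. dim_col M)"
  by (rule carrier_matI) (simp_all add: hcat_def length_concat_cols)

text \<open>Each column of \<open>hcat k Ns\<close> is a column of a single block \<open>N\<close>,
  so each entry of the product is already an entry of some
  \<open>transpose_mat M * N\<close>.\<close>

lemma transpose_mult_hcat_eq_0:
  assumes M: "M \<in> carrier_mat k c"
    and Ns: "\<And>N. N \<in> set Ns \<Longrightarrow> dim_row N = k"
    and orth: "\<And>N. N \<in> set Ns \<Longrightarrow> transpose_mat M * N = 0\<^sub>m c (dim_col N)"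
  shows "transpose_mat M * hcat k Ns = 0\<^sub>m c (\<Sum>N\<leftarrow>Ns. dim_col N)"
proof (rule eq_matI)
  fix i j assume "i < dim_row (0\<^sub>m c (\<Sum>N\<leftarrow>Ns. dim_col N) :: real mat)"
    and "j < dim_col (0\<^sub>m c (\<Sum>N\<leftarrow>Ns. dim_col N) :: real mat)"
  then have i: "i < c" and j: "j < length (concat (map cols Ns))"
    by (simp_all add: length_concat_cols)
  from nth_mem[OF j] obtain N l where N: "N \<in> set Ns" "l < dim_col N"
      and col: "concat (map cols Ns) ! j = col N l"
    by (auto simp: cols_def)
  have "col (hcat k Ns) j = col N l"
    unfolding hcat_def using j col Ns[OF N(1)] by (subst col_mat_of_cols) auto
  then have "(transpose_mat M * hcat k Ns) $$ (i, j) = (transpose_mat M * N) $$ (i, l)"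
    using i j N M by (simp add: hcat_def)
  then show "(transpose_mat M * hcat k Ns) $$ (i, j) = 0\<^sub>m c (\<Sum>N\<leftarrow>Ns. dim_col N) $$ (i, j)"
    using orth[OF N(1)] i j N by (simp add: length_concat_cols)
qed (use M in \<open>auto simp: carrier_matD(2)[OF hcat_carrier]\<close>)

text \<open>The two lower blocks have no rows. Writing a row of two blocks in this degenerate form
  makes the transposition and multiplication rules for \<open>four_block_mat\<close>
  available.\<close>

lemma hcat_Cons:
  assumes M: "M \<in> carrier_mat k c" and N: "hcat k Ms \<in> carrier_mat k d"
  shows "hcat k (M # Ms) = four_block_mat M (hcat k Ms) (0\<^sub>m 0 c) (0\<^sub>m 0 d)"
proof (rule eq_matI)
  have d: "length (concat (map cols Ms)) = d" using carrier_matD(2)[OF N] by (simp add: hcat_def)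
  fix i j assume "i < dim_row (four_block_mat M (hcat k Ms) (0\<^sub>m 0 c) (0\<^sub>m 0 d))"
    and "j < dim_col (four_block_mat M (hcat k Ms) (0\<^sub>m 0 c) (0\<^sub>m 0 d))"
  then have "i < k" "j < c + d" using M N by auto
  then show "hcat k (M # Ms) $$ (i, j) = four_block_mat M (hcat k Ms) (0\<^sub>m 0 c) (0\<^sub>m 0 d) $$ (i, j)"
    using M d by (auto simp: hcat_def mat_of_cols_def nth_append)
qed (use M N in \<open>auto simp: hcat_def\<close>)

text \<open>Splitting off the first block leaves off-diagonal blocks that vanish by
  \<open>transpose_mult_hcat_eq_0\<close>. The relation is required only for an earlier block on the
  left; the opposite products are transposes of these.\<close>

lemma gram_hcat_orthogonal:
  assumes "\<And>M. M \<in> set Ms \<Longrightarrow> dim_row M = k"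
    and "sorted_wrt (\<lambda>M N. transpose_mat M * N = 0\<^sub>m (dim_col M) (dim_col N)) Ms"
  shows "transpose_mat (hcat k Ms) * hcat k Ms = diag_block_mat (map (\<lambda>M. transpose_mat M * M) Ms)"
  using assms
proof (induction Ms)
  case Nil
  show ?case by (intro eq_matI) (auto simp: hcat_def)
next
  case (Cons M Ms)
  define c d where "c = dim_col M" and "d = (\<Sum>M\<leftarrow>Ms. dim_col M)"
  define X where "X = hcat k Ms"
  have M: "M \<in> carrier_mat k c" using Cons.prems by (auto simp: c_def)
  have X: "X \<in> carrier_mat k d" unfolding X_def d_def by simp
  have MX: "transpose_mat M * X = 0\<^sub>m c d"
    unfolding X_def d_def
    by (rule transpose_mult_hcat_eq_0[OF M]) (use Cons.prems in \<open>auto simp: c_def\<close>)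
  have XM: "transpose_mat X * M = 0\<^sub>m d c"
    using transpose_mult[of "transpose_mat M" c k X d] MX M X by simp
  have IH: "transpose_mat X * X = diag_block_mat (map (\<lambda>M. transpose_mat M * M) Ms)"
    unfolding X_def using Cons by auto
  have "transpose_mat (hcat k (M # Ms)) * hcat k (M # Ms) =
      four_block_mat (transpose_mat M) (0\<^sub>m c 0) (transpose_mat X) (0\<^sub>m d 0)
      * four_block_mat M X (0\<^sub>m 0 c) (0\<^sub>m 0 d)"
    unfolding hcat_Cons[OF M X[unfolded X_def]] X_def[symmetric]
    using transpose_four_block_mat[OF M X zero_carrier_mat[of 0 c] zero_carrier_mat[of 0 d]] by simp
  also have "\<dots> = four_block_mat (transpose_mat M * M) (0\<^sub>m c d) (0\<^sub>m d c) (transpose_mat X * X)"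
    using M X MX XM by (subst mult_four_block_mat[of _ c k _ 0 _ d]) auto
  also have "\<dots> = diag_block_mat (map (\<lambda>M. transpose_mat M * M) (M # Ms))"
    using M X by (simp add: Let_def IH[symmetric])
  finally show ?case .
qed

text \<open>The determinant of a block diagonal matrix is the product of those of its blocks, so no
  block is singular. This is essential, since \<open>mat_inv\<close> is unspecified on singular
  matrices.\<close>

lemma mat_inv_diag_block_mat:
  assumes "\<And>M. M \<in> set Ms \<Longrightarrow> square_mat M" and "det (diag_block_mat Ms) \<noteq> 0"
  shows "mat_inv (diag_block_mat Ms) = diag_block_mat (map mat_inv Ms)"
  using assms
proof (induction Ms)
  case Nil
  show ?case by (simp, rule mat_inv_eqI[of _ 0]) auto
next
  case (Cons M Ms)
  define c where "c = dim_row M"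
  define D where "D = diag_block_mat Ms"
  define d where "d = dim_row D"
  have M: "M \<in> carrier_mat c c" using Cons.prems(1) by (auto simp: c_def)
  have "square_mat D" unfolding D_def using Cons.prems(1) by (intro diag_block_mat_square) auto
  then have D: "D \<in> carrier_mat d d" by (auto simp: d_def)
  have diag: "diag_block_mat (M # Ms) = four_block_mat M (0\<^sub>m c d) (0\<^sub>m d c) D"
    using M D by (simp add: D_def[symmetric] Let_def)
  have "det (diag_block_mat (M # Ms)) = det M * det D"
    unfolding diag by (rule det_four_block_mat_lower_left_zero[OF M _ _ D]) auto
  then have dets: "det M \<noteq> 0" "det D \<noteq> 0" using Cons.prems(2) by auto
  have IH: "mat_inv D = diag_block_mat (map mat_inv Ms)"
    using Cons.IH Cons.prems(1) dets(2) by (simp add: D_def)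
  note Mi = mat_inv_nonsingular[OF M dets(1)]
  note Di = mat_inv_nonsingular[OF D dets(2)]
  have "mat_inv (four_block_mat M (0\<^sub>m c d) (0\<^sub>m d c) D)
      = four_block_mat (mat_inv M) (0\<^sub>m c d) (0\<^sub>m d c) (mat_inv D)"
  proof (rule mat_inv_left_inverse[of _ "c + d"])
    show "four_block_mat M (0\<^sub>m c d) (0\<^sub>m d c) D
        * four_block_mat (mat_inv M) (0\<^sub>m c d) (0\<^sub>m d c) (mat_inv D) = 1\<^sub>m (c + d)"
      using M D Mi Di by (subst mult_four_block_mat[of _ c c _ d _ d]) auto
  qed (use M D Mi Di in auto)
  also have "\<dots> = diag_block_mat (map mat_inv (M # Ms))"
    using Mi(1) Di(1) by (simp add: IH[symmetric] Let_def)
  finally show ?case unfolding diag .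
qed

section \<open>Arithmetic of vertically stacked matrices\<close>

lemma append_rows_mult:
  fixes M N :: "'a :: semiring_0 mat"
  assumes M: "M \<in> carrier_mat k n" and N: "N \<in> carrier_mat l n" and X: "X \<in> carrier_mat n c"
  shows "(M @\<^sub>r N) * X = (M * X) @\<^sub>r (N * X)"
proof (rule eq_matI)
  fix i j assume "i < dim_row ((M * X) @\<^sub>r (N * X))" and "j < dim_col ((M * X) @\<^sub>r (N * X))"
  then have "i < k + l" "j < c" using M N X by (auto simp: append_rows_def)
  moreover have "row (M @\<^sub>r N) i = (if i < k then row M i else row N (i - k))" if "i < k + l"
    using that M N by (intro eq_vecI) (auto simp: append_rows_def)
  ultimately show "((M @\<^sub>r N) * X) $$ (i, j) = ((M * X) @\<^sub>r (N * X)) $$ (i, j)"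
    using M N X by (auto simp: append_rows_def)
qed (use M N X in \<open>auto simp: append_rows_def\<close>)

lemma append_rows_minus:
  fixes M N :: "'a :: group_add mat"
  assumes "M \<in> carrier_mat k n" "N \<in> carrier_mat l n" "M' \<in> carrier_mat k n" "N' \<in> carrier_mat l n"
  shows "(M @\<^sub>r N) - (M' @\<^sub>r N') = (M - M') @\<^sub>r (N - N')"
  by (rule eq_matI) (use assms in \<open>auto simp: append_rows_def\<close>)

lemma append_rows_inject:
  fixes M N :: "'a :: zero mat"
  assumes M: "M \<in> carrier_mat k n" "M' \<in> carrier_mat k n"
    and N: "N \<in> carrier_mat l n" "N' \<in> carrier_mat l n"
    and eq: "M @\<^sub>r N = M' @\<^sub>r N'"
  shows "M = M' \<and> N = N'"
proof (intro conjI eq_matI)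
  have entry: "(M @\<^sub>r N) $$ (i, j) = (M' @\<^sub>r N') $$ (i, j)" for i j using eq by simp
  show "M $$ (i, j) = M' $$ (i, j)" if "i < dim_row M'" "j < dim_col M'" for i j
    using entry[of i j] that M N by (simp add: append_rows_def)
  show "N $$ (i, j) = N' $$ (i, j)" if "i < dim_row N'" "j < dim_col N'" for i j
    using entry[of "i + k" j] that M N by (simp add: append_rows_def)
qed (use M N in auto)

text \<open>The version of \<open>gram_append_rows\<close> with two different stacked factors,
  needed for the product of the transpose of \<open>Abar\<close> with \<open>Y\<close>.\<close>

lemma transpose_append_rows_mult:
  fixes M N X Z :: "'a :: comm_semiring_0 mat"
  assumes M: "M \<in> carrier_mat k n" and N: "N \<in> carrier_mat l n"
    and X: "X \<in> carrier_mat k c" and Z: "Z \<in> carrier_mat l c"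
  shows "transpose_mat (M @\<^sub>r N) * (X @\<^sub>r Z) = transpose_mat M * X + transpose_mat N * Z"
proof (rule eq_matI)
  fix i j assume "i < dim_row (transpose_mat M * X + transpose_mat N * Z)"
    and "j < dim_col (transpose_mat M * X + transpose_mat N * Z)"
  then have ij: "i < n" "j < c" using assms by auto
  have "col (M @\<^sub>r N) i = col M i @\<^sub>v col N i"
    using ij M N by (intro eq_vecI) (auto simp: append_rows_def)
  moreover have "col (X @\<^sub>r Z) j = col X j @\<^sub>v col Z j"
    using ij X Z by (intro eq_vecI) (auto simp: append_rows_def)
  moreover have "dim_col (M @\<^sub>r N) = n" "dim_col (X @\<^sub>r Z) = c"
    using assms by (auto simp: append_rows_def)
  moreover have "col M i \<in> carrier_vec k" "col N i \<in> carrier_vec l"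
    "col X j \<in> carrier_vec k" "col Z j \<in> carrier_vec l"
    using assms by auto
  ultimately show "(transpose_mat (M @\<^sub>r N) * (X @\<^sub>r Z)) $$ (i, j) =
      (transpose_mat M * X + transpose_mat N * Z) $$ (i, j)"
    using ij assms by (simp add: scalar_prod_append[where ?n1.0 = k and ?n2.0 = l])
qed (use assms in \<open>auto simp: append_rows_def\<close>)

section \<open>The Woodbury identity and the Gram matrix of the augmented system\<close>

lemma add_minus_cancel_mat:
  fixes X Z :: "'a :: ab_group_add mat"
  assumes "X \<in> carrier_mat k l" "Z \<in> carrier_mat k l"
  shows "X + Z - Z = X"
  using assms by (intro eq_matI) auto

text \<open>Let \<open>H\<close> and \<open>T\<close> be as defined in the proof. Both claims rest
  on \<open>\<Gamma>t * T = H * (R * \<Gamma>t)\<close>: multiplied by \<open>G\<close> from the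
  left it becomes \<open>G * (\<Gamma>t * T) = R * \<Gamma>t\<close>. The first product then
  collapses to \<open>T - \<Gamma> * (R * \<Gamma>t)\<close>, and the second expression to
  \<open>R * C + R * (\<Gamma>t * \<Gamma>)\<close>.\<close>

lemma woodbury_identity:
  fixes C R G \<Gamma> :: "'a :: field mat"
  assumes C: "C \<in> carrier_mat n n" and R: "R \<in> carrier_mat n n" and G: "G \<in> carrier_mat n n"
    and \<Gamma>: "\<Gamma> \<in> carrier_mat q n"
    and CR: "C * R = 1\<^sub>m n" and GH: "G * (C + transpose_mat \<Gamma> * \<Gamma>) = 1\<^sub>m n"
  shows "(1\<^sub>m q - \<Gamma> * (G * transpose_mat \<Gamma>)) * (1\<^sub>m q + \<Gamma> * (R * transpose_mat \<Gamma>)) = 1\<^sub>m q"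
    and "1\<^sub>m n + G * transpose_mat \<Gamma> * (1\<^sub>m q + \<Gamma> * (R * transpose_mat \<Gamma>)) * \<Gamma>
      = R * (C + transpose_mat \<Gamma> * \<Gamma>)"
proof -
  define \<Gamma>t where "\<Gamma>t = transpose_mat \<Gamma>"
  define H T where "H = C + \<Gamma>t * \<Gamma>" and "T = 1\<^sub>m q + \<Gamma> * (R * \<Gamma>t)"
  have \<Gamma>t: "\<Gamma>t \<in> carrier_mat n q" using \<Gamma> by (simp add: \<Gamma>t_def)
  have H: "H \<in> carrier_mat n n" using C \<Gamma> \<Gamma>t by (simp add: H_def)
  have R\<Gamma>t: "R * \<Gamma>t \<in> carrier_mat n q" using R \<Gamma>t by simp
  have \<Gamma>R\<Gamma>t: "\<Gamma> * (R * \<Gamma>t) \<in> carrier_mat q q" using R\<Gamma>t \<Gamma> by simp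
  have T: "T \<in> carrier_mat q q" using \<Gamma>R\<Gamma>t by (simp add: T_def)
  have RC: "R * C = 1\<^sub>m n" using mat_mult_left_right_inverse[OF C R CR] .
  have GH': "G * H = 1\<^sub>m n" using GH by (simp add: H_def \<Gamma>t_def)
  have CR\<Gamma>t: "C * (R * \<Gamma>t) = \<Gamma>t" using assoc_mult_mat[OF C R \<Gamma>t] CR \<Gamma>t by simp
  have \<Gamma>tT: "\<Gamma>t * T = H * (R * \<Gamma>t)"
  proof -
    have "H * (R * \<Gamma>t) = C * (R * \<Gamma>t) + \<Gamma>t * \<Gamma> * (R * \<Gamma>t)"
      unfolding H_def using C \<Gamma> \<Gamma>t R\<Gamma>t by (intro add_mult_distrib_mat) auto
    also have "\<dots> = \<Gamma>t + \<Gamma>t * (\<Gamma> * (R * \<Gamma>t))"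
      using CR\<Gamma>t assoc_mult_mat[OF \<Gamma>t \<Gamma> R\<Gamma>t] by simp
    also have "\<dots> = \<Gamma>t * T"
      unfolding T_def using mult_add_distrib_mat[OF \<Gamma>t one_carrier_mat \<Gamma>R\<Gamma>t] \<Gamma>t by simp
    finally show ?thesis ..
  qed
  have G\<Gamma>tT: "G * (\<Gamma>t * T) = R * \<Gamma>t"
    unfolding \<Gamma>tT using assoc_mult_mat[OF G H R\<Gamma>t, unfolded GH'] left_mult_one_mat[OF R\<Gamma>t] by simp
  have G\<Gamma>t: "G * \<Gamma>t \<in> carrier_mat n q" using G \<Gamma>t by simp
  have "(1\<^sub>m q - \<Gamma> * (G * \<Gamma>t)) * T = T - \<Gamma> * (G * (\<Gamma>t * T))"
    using minus_mult_distrib_mat[OF one_carrier_mat _ T, of "\<Gamma> * (G * \<Gamma>t)"]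
      assoc_mult_mat[OF \<Gamma> G\<Gamma>t T] assoc_mult_mat[OF G \<Gamma>t T] \<Gamma> G\<Gamma>t T by simp
  also have "\<dots> = 1\<^sub>m q"
    unfolding G\<Gamma>tT unfolding T_def using add_minus_cancel_mat[OF one_carrier_mat \<Gamma>R\<Gamma>t] .
  finally show "(1\<^sub>m q - \<Gamma> * (G * transpose_mat \<Gamma>)) * (1\<^sub>m q + \<Gamma> * (R * transpose_mat \<Gamma>)) = 1\<^sub>m q"
    by (simp add: T_def \<Gamma>t_def)
  have "G * \<Gamma>t * T * \<Gamma> = R * (\<Gamma>t * \<Gamma>)"
    using assoc_mult_mat[OF G \<Gamma>t T] G\<Gamma>tT assoc_mult_mat[OF R \<Gamma>t \<Gamma>] by simp
  then have "1\<^sub>m n + G * \<Gamma>t * T * \<Gamma> = R * H"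
    unfolding H_def using mult_add_distrib_mat[OF R C, of "\<Gamma>t * \<Gamma>"] RC \<Gamma>t \<Gamma> by simp
  then show "1\<^sub>m n + G * transpose_mat \<Gamma> * (1\<^sub>m q + \<Gamma> * (R * transpose_mat \<Gamma>)) * \<Gamma>
      = R * (C + transpose_mat \<Gamma> * \<Gamma>)"
    by (simp add: H_def T_def \<Gamma>t_def)
qed

text \<open>The column block of \<open>B\<close> over \<open>S\<close> is the residual of projecting
  the stacked matrix (0, I) onto the columns of \<open>A\<close> over \<open>\<Gamma>\<close>. It is
  orthogonal to those columns, so the mixed blocks vanish. Its own Gram matrix equals its product
  with (0, I), which is \<open>S\<close>. The second claim serves to evaluate the right-hand side of
  the normal equations of (P2).\<close>

lemma gram_augmented:
  fixes A \<Gamma> :: "'a :: field mat"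
  assumes A: "A \<in> carrier_mat m n" and \<Gamma>: "\<Gamma> \<in> carrier_mat q n" and G: "G \<in> carrier_mat n n"
    and HG: "(transpose_mat A * A + transpose_mat \<Gamma> * \<Gamma>) * G = 1\<^sub>m n"
    and G_sym: "transpose_mat G = G"
    and B: "B = - (A * (G * transpose_mat \<Gamma>))" and S: "S = 1\<^sub>m q - \<Gamma> * (G * transpose_mat \<Gamma>)"
  shows "transpose_mat (four_block_mat A B \<Gamma> S) * four_block_mat A B \<Gamma> S
    = four_block_mat (transpose_mat A * A + transpose_mat \<Gamma> * \<Gamma>) (0\<^sub>m n q) (0\<^sub>m q n) S"
    and "transpose_mat B = - (\<Gamma> * (G * transpose_mat A))"
proof -
  define At \<Gamma>t where "At = transpose_mat A" and "\<Gamma>t = transpose_mat \<Gamma>"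
  have At: "At \<in> carrier_mat n m" and \<Gamma>t: "\<Gamma>t \<in> carrier_mat n q"
    using A \<Gamma> by (simp_all add: At_def \<Gamma>t_def)
  define H U where "H = At * A + \<Gamma>t * \<Gamma>" and "U = G * \<Gamma>t"
  have U: "U \<in> carrier_mat n q" using G \<Gamma>t by (simp add: U_def)
  have AU: "A * U \<in> carrier_mat m q" and \<Gamma>U: "\<Gamma> * U \<in> carrier_mat q q"
    using A \<Gamma> U by simp_all
  have B_U: "B = - (A * U)" and S_U: "S = 1\<^sub>m q - \<Gamma> * U"
    using B S by (simp_all add: U_def \<Gamma>t_def)
  have Bc: "B \<in> carrier_mat m q" and Sc: "S \<in> carrier_mat q q"
    using AU minus_carrier_mat[OF \<Gamma>U] by (simp_all add: B_U S_U)
  have Bt: "transpose_mat B \<in> carrier_mat q m" using Bc by simp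
  have Ut: "transpose_mat U = \<Gamma> * G"
    using transpose_mult[OF G \<Gamma>t] G_sym by (simp add: U_def \<Gamma>t_def)
  have "transpose_mat B = - transpose_mat (A * U)"
    unfolding B_U using AU by (intro eq_matI) auto
  also have "transpose_mat (A * U) = \<Gamma> * (G * At)"
    using transpose_mult[OF A U] Ut assoc_mult_mat[OF \<Gamma> G At] by (simp add: At_def)
  finally show "transpose_mat B = - (\<Gamma> * (G * transpose_mat A))" by (simp add: At_def)
  have S_sym: "transpose_mat S = S"
  proof -
    have "transpose_mat (\<Gamma> * U) = \<Gamma> * U"
      using transpose_mult[OF \<Gamma> U] Ut assoc_mult_mat[OF \<Gamma> G \<Gamma>t] by (simp add: U_def \<Gamma>t_def)
    then show ?thesis
      unfolding S_U using transpose_minus[OF one_carrier_mat \<Gamma>U] by simp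
  qed
  \<comment> \<open>These are the normal equations of that projection, with \<open>U\<close> as the
    matrix of coefficients.\<close>
  have "H * U = \<Gamma>t"
  proof -
    have H: "H \<in> carrier_mat n n" using At A \<Gamma>t \<Gamma> by (simp add: H_def)
    show ?thesis unfolding U_def
      using assoc_mult_mat[OF H G \<Gamma>t] HG \<Gamma>t by (simp add: H_def At_def \<Gamma>t_def)
  qed
  moreover have "H * U = At * (A * U) + \<Gamma>t * (\<Gamma> * U)"
    unfolding H_def
    using add_mult_distrib_mat[of "At * A" n n "\<Gamma>t * \<Gamma>" U q] At A \<Gamma>t \<Gamma> U
      assoc_mult_mat[OF At A U] assoc_mult_mat[OF \<Gamma>t \<Gamma> U] by simp
  ultimately have sum: "At * (A * U) + \<Gamma>t * (\<Gamma> * U) = \<Gamma>t" by simp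
  have AtB: "At * B = - (At * (A * U))"
    unfolding B_U using At A U by simp
  have \<Gamma>tS: "\<Gamma>t * S = \<Gamma>t - \<Gamma>t * (\<Gamma> * U)"
    unfolding S_U using mult_minus_distrib_mat[OF \<Gamma>t one_carrier_mat \<Gamma>U] \<Gamma>t by simp
  have upper: "At * B + \<Gamma>t * S = 0\<^sub>m n q"
  proof (rule eq_matI)
    fix i j assume ij: "i < dim_row (0\<^sub>m n q :: 'a mat)" "j < dim_col (0\<^sub>m n q :: 'a mat)"
    have X: "At * (A * U) \<in> carrier_mat n q" "\<Gamma>t * (\<Gamma> * U) \<in> carrier_mat n q"
      using At AU \<Gamma>t \<Gamma>U by simp_all
    have "(At * (A * U)) $$ (i, j) + (\<Gamma>t * (\<Gamma> * U)) $$ (i, j) = \<Gamma>t $$ (i, j)"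
      using arg_cong[OF sum, of "\<lambda>M. M $$ (i, j)"] ij carrier_matD[OF X(2)] by (simp del: index_mult_mat)
    then show "(At * B + \<Gamma>t * S) $$ (i, j) = 0\<^sub>m n q $$ (i, j)"
      unfolding AtB \<Gamma>tS using ij carrier_matD[OF X(1)] carrier_matD[OF X(2)] carrier_matD[OF \<Gamma>t]
      by (simp del: index_mult_mat add: algebra_simps)
  qed (use At Bc \<Gamma>t Sc in auto)
  have lower: "transpose_mat B * A + transpose_mat S * \<Gamma> = 0\<^sub>m q n"
  proof -
    have "transpose_mat B * A + transpose_mat S * \<Gamma> = transpose_mat (At * B + \<Gamma>t * S)"
      using transpose_add[of "At * B" n q "\<Gamma>t * S"] transpose_mult[OF At Bc]
        transpose_mult[OF \<Gamma>t Sc] At Bc \<Gamma>t Sc by (simp add: At_def \<Gamma>t_def)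
    then show ?thesis by (simp add: upper)
  qed
  \<comment> \<open>Substituting for the right factors \<open>B\<close> and \<open>S\<close> leaves
    \<open>S\<close> minus a product of the form (...) * \<open>U\<close>, whose first factor
    vanishes by \<open>lower\<close>.\<close>
  have right: "transpose_mat B * B + transpose_mat S * S = S"
  proof -
    have "transpose_mat B * B = - (transpose_mat B * A * U)"
      unfolding assoc_mult_mat[OF Bt A U] using Bt AU by (simp add: B_U)
    moreover have "transpose_mat S * S = S - transpose_mat S * \<Gamma> * U"
      using mult_minus_distrib_mat[OF Sc one_carrier_mat \<Gamma>U] assoc_mult_mat[OF Sc \<Gamma> U] Sc
      unfolding S_sym by (simp flip: S_U)
    moreover have "transpose_mat B * A * U + transpose_mat S * \<Gamma> * U = 0\<^sub>m q q"
      using add_mult_distrib_mat[of "transpose_mat B * A" q n "transpose_mat S * \<Gamma>" U q]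
        lower Bt A Sc \<Gamma> U by simp
    \<comment> \<open>\<open>X\<close> and \<open>Z\<close> stand for the two summands of that
      product, which cancel each other.\<close>
    moreover have "- X + (S - Z) = S"
      if XZ: "X + Z = 0\<^sub>m q q" and X: "X \<in> carrier_mat q q" and Z: "Z \<in> carrier_mat q q" for X Z
    proof (rule eq_matI)
      fix i j assume ij: "i < dim_row S" "j < dim_col S"
      then have "X $$ (i, j) + Z $$ (i, j) = 0"
        using arg_cong[OF XZ, of "\<lambda>M. M $$ (i, j)"] Z Sc by simp
      then show "(- X + (S - Z)) $$ (i, j) = S $$ (i, j)"
        using ij X Z Sc by (simp add: algebra_simps)
    qed (use X Z Sc in auto)
    ultimately show ?thesis using Bt A Sc \<Gamma> U by simp
  qed
  have "transpose_mat (four_block_mat A B \<Gamma> S) * four_block_mat A B \<Gamma> S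
      = four_block_mat H (At * B + \<Gamma>t * S)
          (transpose_mat B * A + transpose_mat S * \<Gamma>) (transpose_mat B * B + transpose_mat S * S)"
    unfolding transpose_four_block_mat[OF A Bc \<Gamma> Sc] H_def At_def \<Gamma>t_def
    by (rule mult_four_block_mat) (use A Bc \<Gamma> Sc in auto)
  then show "transpose_mat (four_block_mat A B \<Gamma> S) * four_block_mat A B \<Gamma> S
    = four_block_mat (transpose_mat A * A + transpose_mat \<Gamma> * \<Gamma>) (0\<^sub>m n q) (0\<^sub>m q n) S"
    unfolding upper lower right by (simp add: H_def At_def \<Gamma>t_def)
qed

section \<open>Solving both least squares problems and comparing the solutions\<close>

theorem lemma8:
  fixes m n q p :: nat and ns :: "nat \<Rightarrow> nat"
    and Ab Gb :: "nat \<Rightarrow> real mat"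
    and A \<Gamma> Abar P Y W B S G \<Omega> K :: "real mat"
    and b :: "real vec"
  assumes "n \<le> m" and "1 \<le> q"
    and "(\<Sum>i = 1..p. ns i) = n"
    and "\<And>i. i \<in> {1..p} \<Longrightarrow> Ab i \<in> carrier_mat m (ns i)"
    and "\<And>i. i \<in> {1..p} \<Longrightarrow> Gb i \<in> carrier_mat q (ns i)"
    and "A = hcat m (map Ab [1..<Suc p])"
    and "\<Gamma> = hcat q (map Gb [1..<Suc p])"
    and "\<And>i j. i \<in> {1..p} \<Longrightarrow> j \<in> {1..p} \<Longrightarrow> i \<noteq> j \<Longrightarrow>
           transpose_mat (Ab i @\<^sub>r Gb i) * (Ab j @\<^sub>r Gb j) = 0\<^sub>m (ns i) (ns j)"
    and "vec_space.rank m A = n"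
    and "b \<in> carrier_vec m"
    and "Abar = A @\<^sub>r \<Gamma>"
    and "P = Abar * pinv Abar"
    and "Y = 0\<^sub>m m q @\<^sub>r 1\<^sub>m q"
    and "W = (1\<^sub>m (m + q) - P) * Y"
    and "B \<in> carrier_mat m q" and "S \<in> carrier_mat q q" and "W = B @\<^sub>r S"
    and "G = mat_inv (transpose_mat Abar * Abar)"
    and "\<Omega> = 1\<^sub>m n + G * transpose_mat \<Gamma> * mat_inv S * \<Gamma>"
    and "K = four_block_mat A B \<Gamma> S"
  shows "(\<forall>x y z. is_min_norm_ls A b x
           \<and> y = mat_inv \<Omega> *\<^sub>v x \<and> z = - (mat_inv S *\<^sub>v (\<Gamma> *\<^sub>v y))
           \<longrightarrow> is_min_norm_ls K (b @\<^sub>v 0\<^sub>v q) (y @\<^sub>v z))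
         \<and> (\<forall>y \<in> carrier_vec n. \<forall>z \<in> carrier_vec q.
           is_min_norm_ls K (b @\<^sub>v 0\<^sub>v q) (y @\<^sub>v z)
           \<longrightarrow> z = - (mat_inv S *\<^sub>v (\<Gamma> *\<^sub>v y)) \<and> is_min_norm_ls A b (\<Omega> *\<^sub>v y))
         \<and> is_min_norm_ls K (b @\<^sub>v 0\<^sub>v q)
           ((G *\<^sub>v (transpose_mat A *\<^sub>v b))
             @\<^sub>v - (mat_inv S *\<^sub>v (\<Gamma> *\<^sub>v (G *\<^sub>v (transpose_mat A *\<^sub>v b)))))
         \<and> G = diag_block_mat
           (map (\<lambda>i. mat_inv (transpose_mat (Ab i @\<^sub>r Gb i) * (Ab i @\<^sub>r Gb i))) [1..<Suc p])"
proof -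
  note ns = assms(3) and Ab = assms(4) and Gb = assms(5) and A_def = assms(6) and \<Gamma>_def = assms(7)
    and orth = assms(8) and rank = assms(9) and b = assms(10) and Abar_def = assms(11)
    and P_def = assms(12) and Y_def = assms(13) and W_def = assms(14) and Bc = assms(15)
    and Sc = assms(16) and W_split = assms(17) and G_def = assms(18) and \<Omega>_def = assms(19)
    and K_def = assms(20)
  have ns_list: "(\<Sum>i\<leftarrow>[1..<Suc p]. ns i) = n"
    using ns by (simp add: sum_list_distinct_conv_sum_set atLeastLessThanSuc_atLeastAtMost del: upt_Suc)
  have "map dim_col (map Ab [1..<Suc p]) = map ns [1..<Suc p]"
    "map dim_col (map Gb [1..<Suc p]) = map ns [1..<Suc p]"
    using carrier_matD(2)[OF Ab] carrier_matD(2)[OF Gb] by (auto simp del: upt_Suc)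
  then have dims: "(\<Sum>M\<leftarrow>map Ab [1..<Suc p]. dim_col M) = n"
    "(\<Sum>M\<leftarrow>map Gb [1..<Suc p]. dim_col M) = n"
    unfolding ns_list[symmetric] by argo+
  have A: "A \<in> carrier_mat m n" and \<Gamma>: "\<Gamma> \<in> carrier_mat q n"
    unfolding A_def \<Gamma>_def using hcat_carrier[of m "map Ab [1..<Suc p]", unfolded dims]
      hcat_carrier[of q "map Gb [1..<Suc p]", unfolded dims] by blast+
  define At \<Gamma>t where "At = transpose_mat A" and "\<Gamma>t = transpose_mat \<Gamma>"
  have At: "At \<in> carrier_mat n m" and \<Gamma>t: "\<Gamma>t \<in> carrier_mat n q"
    using A \<Gamma> by (simp_all add: At_def \<Gamma>t_def)
  define H where "H = At * A + \<Gamma>t * \<Gamma>"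
  have Abar: "Abar \<in> carrier_mat (m + q) n" using A \<Gamma> by (simp add: Abar_def)
  have gram_Abar: "transpose_mat Abar * Abar = H"
    unfolding Abar_def H_def At_def \<Gamma>t_def using gram_append_rows[OF A \<Gamma>] .
  have kernel_A: "v = 0\<^sub>v n" if "v \<in> carrier_vec n" "A *\<^sub>v v = 0\<^sub>v m" for v
    using full_column_rank_kernel[OF A rank that] .
  \<comment> \<open>Stacking further rows below \<open>A\<close> can only shrink the kernel.\<close>
  have kernel_Abar: "v = 0\<^sub>v n" if v: "v \<in> carrier_vec n" "Abar *\<^sub>v v = 0\<^sub>v (m + q)" for v
  proof -
    have "A *\<^sub>v v @\<^sub>v \<Gamma> *\<^sub>v v = 0\<^sub>v m @\<^sub>v 0\<^sub>v q"
      using v mat_mult_append[OF A \<Gamma> v(1)] by (auto simp: Abar_def intro!: eq_vecI)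
    then have "A *\<^sub>v v = 0\<^sub>v m" 
      using append_vec_eq[OF mult_mat_vec_carrier[OF A v(1)] zero_carrier_vec] by blast
    then show ?thesis using kernel_A[OF v(1)] by simp
  qed
  have C: "At * A \<in> carrier_mat n n" and H: "H \<in> carrier_mat n n"
    using At A \<Gamma>t \<Gamma> by (simp_all add: H_def)
  have det_C: "det (At * A) \<noteq> 0" unfolding At_def using det_gram_nonzero[OF A kernel_A] .
  have det_H: "det H \<noteq> 0" using det_gram_nonzero[OF Abar kernel_Abar] gram_Abar by simp
  define R where "R = mat_inv (At * A)"
  note R = mat_inv_nonsingular[OF C det_C, folded R_def]
  have G_H: "G = mat_inv H" unfolding G_def gram_Abar ..
  note G = mat_inv_nonsingular[OF H det_H, folded G_H]
  have H_sym: "transpose_mat H = H"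
    using transpose_mult[OF transpose_carrier_mat[THEN iffD2, OF Abar] Abar] gram_Abar by simp
  have G_sym: "transpose_mat G = G"
    using transpose_mat_inv[OF H det_H] H_sym by (simp add: G_H)

  \<comment> \<open>\<open>Y\<close> selects the last \<open>q\<close> rows, so the transpose of
    \<open>Abar\<close> times \<open>Y\<close> is \<open>\<Gamma>t\<close> and
    \<open>P * Y = Abar * (G * \<Gamma>t)\<close>. The blocks of \<open>W\<close> can then be read
    off, because a stacked matrix determines its parts.\<close>
  have BS: "B = - (A * (G * \<Gamma>t)) \<and> S = 1\<^sub>m q - \<Gamma> * (G * \<Gamma>t)"
  proof -
    have Y: "Y \<in> carrier_mat (m + q) q" by (simp add: Y_def)
    have Abart: "transpose_mat Abar \<in> carrier_mat n (m + q)" using Abar by simp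
    have P: "P = Abar * (G * transpose_mat Abar)"
      unfolding P_def using pinv_full_column_rank[OF Abar] det_H by (simp add: gram_Abar G_H)
    have GAbart: "G * transpose_mat Abar \<in> carrier_mat n (m + q)" using G(1) Abart by simp
    have G\<Gamma>t: "G * \<Gamma>t \<in> carrier_mat n q" using G(1) \<Gamma>t by simp
    have "transpose_mat Abar * Y = \<Gamma>t"
      unfolding Abar_def Y_def
      using transpose_append_rows_mult[OF A \<Gamma> zero_carrier_mat one_carrier_mat] At \<Gamma>t
      by (simp add: At_def[symmetric] \<Gamma>t_def[symmetric])
    then have "P * Y = Abar * (G * \<Gamma>t)"
      unfolding P using assoc_mult_mat[OF Abar GAbart Y] assoc_mult_mat[OF G(1) Abart Y] by simp
    also have "\<dots> = (A * (G * \<Gamma>t)) @\<^sub>r (\<Gamma> * (G * \<Gamma>t))"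
      unfolding Abar_def using append_rows_mult[OF A \<Gamma> G\<Gamma>t] .
    finally have PY: "P * Y = (A * (G * \<Gamma>t)) @\<^sub>r (\<Gamma> * (G * \<Gamma>t))" .
    have "P \<in> carrier_mat (m + q) (m + q)" unfolding P using Abar GAbart by simp
    then have "W = Y - P * Y"
      unfolding W_def using minus_mult_distrib_mat[OF one_carrier_mat _ Y] Y by simp
    also have "\<dots> = (0\<^sub>m m q - A * (G * \<Gamma>t)) @\<^sub>r (1\<^sub>m q - \<Gamma> * (G * \<Gamma>t))"
      unfolding PY unfolding Y_def using A \<Gamma> G\<Gamma>t by (intro append_rows_minus) auto
    finally have "B @\<^sub>r S = (0\<^sub>m m q - A * (G * \<Gamma>t)) @\<^sub>r (1\<^sub>m q - \<Gamma> * (G * \<Gamma>t))"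
      using W_split by simp
    then have "B = 0\<^sub>m m q - A * (G * \<Gamma>t) \<and> S = 1\<^sub>m q - \<Gamma> * (G * \<Gamma>t)"
      using A \<Gamma> G\<Gamma>t Bc Sc by (intro append_rows_inject[of _ m q _ _ q] minus_carrier_mat) auto
    moreover have "0\<^sub>m m q - A * (G * \<Gamma>t) = - (A * (G * \<Gamma>t))"
      using A G\<Gamma>t by (intro eq_matI) auto
    ultimately show ?thesis by simp
  qed

  \<comment> \<open>The Woodbury candidate for the inverse of \<open>S\<close>. The invertibility of
    \<open>S\<close> is thereby derived rather than assumed.\<close>
  define T where "T = 1\<^sub>m q + \<Gamma> * (R * \<Gamma>t)"
  have T: "T \<in> carrier_mat q q" using \<Gamma> R(1) \<Gamma>t by (simp add: T_def)
  note woodbury = woodbury_identity[OF C R(1) G(1) \<Gamma> R(3), folded \<Gamma>t_def, folded H_def T_def,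
      OF G(2)]
  have ST: "S * T = 1\<^sub>m q" using woodbury(1) BS by simp
  have S_inv: "mat_inv S = T" using mat_inv_left_inverse[OF Sc T ST] .
  have \<Omega>: "\<Omega> = R * H" unfolding \<Omega>_def S_inv using woodbury(2) by (simp add: \<Gamma>t_def)
  \<comment> \<open>As \<open>\<Omega> = R * H\<close>, its inverse consists of the inverses of
    \<open>H\<close> and \<open>R\<close> in reverse order, namely \<open>G\<close> and
    \<open>At * A\<close>.\<close>
  have \<Omega>_inv: "mat_inv \<Omega> = G * (At * A)"
  proof (rule mat_inv_left_inverse[of _ n])
    have "R * H * (G * (At * A)) = R * ((H * G) * (At * A))"
      using assoc_mult_mat[OF R(1) H, of "G * (At * A)" n] assoc_mult_mat[OF H G(1) C] G(1) C by simp
    then show "\<Omega> * (G * (At * A)) = 1\<^sub>m n" using G(3) R(2) left_mult_one_mat[OF C] \<Omega> by simp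
  qed (use R(1) H G(1) C \<Omega> in auto)

  \<comment> \<open>The closed form of part (iii). Both problems are solved explicitly, and (i) and
    (ii) follow by comparing the formulas.\<close>
  define y\<^sub>0 where "y\<^sub>0 = G *\<^sub>v (At *\<^sub>v b)"
  define z\<^sub>0 where "z\<^sub>0 = - (mat_inv S *\<^sub>v (\<Gamma> *\<^sub>v y\<^sub>0))"
  have Atb: "At *\<^sub>v b \<in> carrier_vec n" using mult_mat_vec_carrier[OF At b] .
  have y\<^sub>0: "y\<^sub>0 \<in> carrier_vec n" using mult_mat_vec_carrier[OF G(1) Atb] by (simp add: y\<^sub>0_def)
  have P1: "is_min_norm_ls A b x \<longleftrightarrow> x = R *\<^sub>v (At *\<^sub>v b)" for x
    unfolding At_def
    by (rule is_min_norm_ls_iff_normal_equations[OF A b R(1) R(3)[unfolded At_def]])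
  have P2: "is_min_norm_ls K (b @\<^sub>v 0\<^sub>v q) w \<longleftrightarrow> w = y\<^sub>0 @\<^sub>v z\<^sub>0" for w
  proof -
    \<comment> \<open>The inverse of the Gram matrix diag(H, S) of \<open>K\<close>, by
      \<open>H * G = 1\<close> and \<open>S * T = 1\<close>.\<close>
    let ?N = "four_block_mat G (0\<^sub>m n q) (0\<^sub>m q n) T"
    have K: "K \<in> carrier_mat (m + q) (n + q)" unfolding K_def using A Sc by simp
    note aug = gram_augmented[OF A \<Gamma> G(1) G(3)[unfolded H_def At_def \<Gamma>t_def] G_sym
        BS[THEN conjunct1, unfolded \<Gamma>t_def] BS[THEN conjunct2, unfolded \<Gamma>t_def],
        folded At_def \<Gamma>t_def, folded H_def K_def]
    have N: "?N \<in> carrier_mat (n + q) (n + q)" using G(1) T by simp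
    have KKN: "transpose_mat K * K * ?N = 1\<^sub>m (n + q)"
      unfolding aug(1) using H G Sc T ST
      by (subst mult_four_block_mat[of _ n n _ q _ q]) auto
    have bq: "b @\<^sub>v 0\<^sub>v q \<in> carrier_vec (m + q)" using b by simp
    have Bt: "transpose_mat B \<in> carrier_mat q m" and St: "transpose_mat S \<in> carrier_mat q q"
      using Bc Sc by simp_all
    have GAt: "G * At \<in> carrier_mat n m" using G(1) At by simp
    \<comment> \<open>The lower half of the right-hand side of the normal equations.
      \<open>transpose_mat S\<close> meets only the zero half of the data, so this term is all that
      remains; applying \<open>T\<close> to it yields \<open>z\<^sub>0\<close>.\<close>
    have Btb: "transpose_mat B *\<^sub>v b = - (\<Gamma> *\<^sub>v y\<^sub>0)"
      unfolding aug(2) y\<^sub>0_def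
      using assoc_mult_mat_vec[OF \<Gamma> GAt b] assoc_mult_mat_vec[OF G(1) At b] At b by simp
    have "transpose_mat K *\<^sub>v (b @\<^sub>v 0\<^sub>v q) = At *\<^sub>v b @\<^sub>v - (\<Gamma> *\<^sub>v y\<^sub>0)"
      unfolding K_def transpose_four_block_mat[OF A Bc \<Gamma> Sc] Btb[symmetric]
      using four_block_mat_mult_vec[of "transpose_mat A" n m "transpose_mat \<Gamma>" q
          "transpose_mat B" q "transpose_mat S" b "0\<^sub>v q"] At \<Gamma>t Bt St b
        mult_mat_vec_zero[OF \<Gamma>t] mult_mat_vec_zero[OF St]
        right_zero_vec[OF Atb] right_zero_vec[OF mult_mat_vec_carrier[OF Bt b]]
      by (simp add: At_def \<Gamma>t_def)
    moreover have "?N *\<^sub>v (At *\<^sub>v b @\<^sub>v - (\<Gamma> *\<^sub>v y\<^sub>0)) = y\<^sub>0 @\<^sub>v z\<^sub>0"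
      unfolding y\<^sub>0_def[symmetric] z\<^sub>0_def S_inv
      using mult_mat_vec_split[OF G(1) T Atb, of "- (\<Gamma> *\<^sub>v y\<^sub>0)"]
        mult_mat_vec_carrier[OF \<Gamma> y\<^sub>0]
        mult_mat_vec_uminus[OF T mult_mat_vec_carrier[OF \<Gamma> y\<^sub>0]]
      by (simp add: y\<^sub>0_def)
    ultimately show ?thesis
      using is_min_norm_ls_iff_normal_equations[OF K bq N KKN] by simp
  qed

  have part1: "is_min_norm_ls K (b @\<^sub>v 0\<^sub>v q) (y @\<^sub>v z)"
    if x: "is_min_norm_ls A b x" and y: "y = mat_inv \<Omega> *\<^sub>v x"
      and z: "z = - (mat_inv S *\<^sub>v (\<Gamma> *\<^sub>v y))" for x y z
  proof -
    \<comment> \<open>Applying the inverse of \<open>\<Omega>\<close> to the solution of (P1)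
      cancels \<open>At * A\<close> against \<open>R\<close> and leaves
      \<open>y\<^sub>0\<close>.\<close>
    have "y = G *\<^sub>v ((At * A) *\<^sub>v (R *\<^sub>v (At *\<^sub>v b)))"
      using x assoc_mult_mat_vec[OF G(1) C mult_mat_vec_carrier[OF R(1) Atb]]
      unfolding y \<Omega>_inv P1 by simp
    also have "\<dots> = y\<^sub>0"
      using assoc_mult_mat_vec[OF C R(1) Atb] R(3) Atb by (simp add: y\<^sub>0_def)
    finally show ?thesis using z by (simp add: P2 z\<^sub>0_def)
  qed
  have part2: "z = - (mat_inv S *\<^sub>v (\<Gamma> *\<^sub>v y)) \<and> is_min_norm_ls A b (\<Omega> *\<^sub>v y)"
    if y: "y \<in> carrier_vec n" and z: "z \<in> carrier_vec q"
      and yz: "is_min_norm_ls K (b @\<^sub>v 0\<^sub>v q) (y @\<^sub>v z)" for y z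
  proof -
    \<comment> \<open>\<open>y\<close> and \<open>y\<^sub>0\<close> both have length
      \<open>n\<close>, so the two concatenated vectors split at the same place.\<close>
    have yz: "y = y\<^sub>0" "z = z\<^sub>0" using yz[unfolded P2] append_vec_eq[OF y y\<^sub>0] by blast+
    have "H *\<^sub>v y\<^sub>0 = At *\<^sub>v b"
      using assoc_mult_mat_vec[OF H G(1) Atb] G(3) Atb by (simp add: y\<^sub>0_def)
    then have "\<Omega> *\<^sub>v y\<^sub>0 = R *\<^sub>v (At *\<^sub>v b)"
      using assoc_mult_mat_vec[OF R(1) H y\<^sub>0] by (simp add: \<Omega>)
    then show ?thesis by (simp add: yz P1 z\<^sub>0_def)
  qed
  have part3: "is_min_norm_ls K (b @\<^sub>v 0\<^sub>v q) (y\<^sub>0 @\<^sub>v z\<^sub>0)" by (simp add: P2)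

  let ?Mb = "\<lambda>i. Ab i @\<^sub>r Gb i"
  have blocks: "H = diag_block_mat (map (\<lambda>i. transpose_mat (?Mb i) * ?Mb i) [1..<Suc p])"
  proof -
    have Mb: "?Mb i \<in> carrier_mat (m + q) (ns i)" if "i \<in> {1..p}" for i
      using Ab[OF that] Gb[OF that] by simp
    have "Abar = hcat (m + q) (map ?Mb [1..<Suc p])"
      unfolding Abar_def A_def \<Gamma>_def
      by (rule hcat_append_rows[where ns = ns, symmetric]) (use Ab Gb in auto)
    moreover have "transpose_mat (hcat (m + q) (map ?Mb [1..<Suc p])) * hcat (m + q) (map ?Mb [1..<Suc p])
        = diag_block_mat (map (\<lambda>M. transpose_mat M * M) (map ?Mb [1..<Suc p]))"
    proof (rule gram_hcat_orthogonal)
      show "dim_row M = m + q" if "M \<in> set (map ?Mb [1..<Suc p])" for M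
        using that carrier_matD(1)[OF Mb] by (auto simp del: upt_Suc)
      have "transpose_mat (?Mb i) * ?Mb j = 0\<^sub>m (dim_col (?Mb i)) (dim_col (?Mb j))"
        if "i \<in> {1..p}" "j \<in> {1..p}" "i < j" for i j
        using orth[OF that(1,2)] that(3) carrier_matD(2)[OF Mb[OF that(1)]] carrier_matD(2)[OF Mb[OF that(2)]]
        by simp
      \<comment> \<open>The index list is strictly increasing, so an earlier index differs from a
        later one and the orthogonality hypothesis applies.\<close>
      then have "sorted_wrt (\<lambda>i j. transpose_mat (?Mb i) * ?Mb j
          = 0\<^sub>m (dim_col (?Mb i)) (dim_col (?Mb j))) [1..<Suc p]"
        by (intro sorted_wrt_mono_rel[OF _ sorted_wrt_upt]) auto
      then show "sorted_wrt (\<lambda>M N. transpose_mat M * N = 0\<^sub>m (dim_col M) (dim_col N))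
          (map ?Mb [1..<Suc p])"
        by (simp add: sorted_wrt_map del: upt_Suc)
    qed
    ultimately show ?thesis using gram_Abar by (simp add: comp_def del: upt_Suc)
  qed
  \<comment> \<open>Nonsingularity of the whole of \<open>H\<close> is enough here; that of the
    individual blocks is extracted from it inside the lemma.\<close>
  have "mat_inv H = diag_block_mat (map mat_inv (map (\<lambda>i. transpose_mat (?Mb i) * ?Mb i) [1..<Suc p]))"
    unfolding blocks by (rule mat_inv_diag_block_mat) (use det_H[unfolded blocks] in auto)
  then have part4: "G = diag_block_mat (map (\<lambda>i. mat_inv (transpose_mat (?Mb i) * ?Mb i)) [1..<Suc p])"
    by (simp add: G_H comp_def del: upt_Suc)
  show ?thesis
    using part1 part2 part3 part4 unfolding y\<^sub>0_def z\<^sub>0_def At_def by blast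
qed

end
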